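(* Let $(\Delta,G,\omega,\zeta)$ be a generalised voltage graph and let $T$ be a spanning tree of $\Delta$. Then there exist a voltage assignment $\zeta'$ and a weight function $\omega'$ (so that $(\Delta,G,\omega',\zeta')$ is a generalised voltage graph) such that $\zeta'(x)=1_G$ for all $x \in D(T)$ and $\mathrm{GenCov}(\Delta,G,\omega,\zeta) \cong \mathrm{GenCov}(\Delta,G,\omega',\zeta')$.
   Context: Graphs. A graph is a quadruple $(V,D,\mathrm{beg},\mathrm{inv})$ where $V$ is a non-empty set of vertices, $D$ is a set of darts (disjoint from $V$), $\mathrm{beg}\colon D\to V$, and $\mathrm{inv}\colon D\to D$ satisfies $\mathrm{inv}\,\mathrm{inv}\,x=x$ for all $x\in D$. For $\Gamma=(V,D,\mathrm{beg},\mathrm{inv})$ write $V(\Gamma)=V$, $D(\Gamma)=D$, $\mathrm{beg}_\Gamma=\mathrm{beg}$, $\mathrm{inv}_\Gamma=\mathrm{inv}$; also $x^{-1}:=\mathrm{inv}\,x$ and $\mathrm{end}\,x:=\mathrm{beg}\,x^{-1}$. A walk is a sequence of darts $(x_1,\dots,x_n)$ with $\mathrm{end}\,x_i=\mathrm{beg}\,x_{i+1}$; a walk of length $0$ is regarded as a walk from any vertex to itself. A graph is connected if for any two vertices $u,v$ there is a walk from $u$ to $v$. A subgraph has a subset of the vertices and a subset of the darts, with $\mathrm{beg}$ and $\mathrm{inv}$ restricted; it is spanning if it contains all vertices. A tree is a connected graph with no cycles (in the usual sense; in particular it has no semi-edges $x=x^{-1}$, no loops and no parallel edges). A spanning tree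 is a spanning subgraph that is a tree. An isomorphism ($\cong$) is a bijection mapping vertices to vertices and darts to darts and commuting with $\mathrm{beg}$ and $\mathrm{inv}$. Generalised voltage graphs. For a group $G$, $S(G)$ is the set of all subgroups of $G$, and $g^h:=h^{-1}gh$, $H^h:=h^{-1}Hh$. A generalised voltage graph is a quadruple $(\Delta,G,\omega,\zeta)$ where $\Delta$ is a connected graph, $G$ is a group, and $\omega\colon V(\Delta)\cup D(\Delta)\to S(G)$ (weight function) and $\zeta\colon D(\Delta)\to G$ (voltage assignment) satisfy, for all $x\in D(\Delta)$: $\omega(x)\le\omega(\mathrm{beg}_\Delta x)$; $\omega(x)=\omega(x^{-1})^{\zeta(x)}$; and $\zeta(x^{-1})\zeta(x)\in\omega(x)$. Generalised cover. $\mathrm{GenCov}(\Delta,G,\omega,\zeta)$ is the graph $\Gamma$ with $V(\Gamma)=\{(v,\omega(v)g): v\in V(\Delta), g\in G\}$, $D(\Gamma)=\{(x,\omega(x)g): x\in D(\Delta), g\in G\}$, $\mathrm{beg}_\Gamma(x,\omega(x)g)=(\mathrm{beg}_\Delta x,\omega(\mathrm{beg}_\Delta x)g)$ and $\mathrm{inv}_\Gamma(x,\omega(x)g)=(x^{-1},\omega(x^{-1})\zeta(x)g)$ (right cosets). *)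

theory Defs
  imports "HOL-Algebra.Coset"
begin

text \<open>Vertices and darts live in separate types, so the two sets are disjoint by construction.
  The functions \<open>beg\<close> and \<open>dinv\<close> are total; only their values on darts matter.\<close>

record ('v, 'd) dgraph =
  verts :: "'v set"
  darts :: "'d set"
  beg :: "'d \<Rightarrow> 'v"
  dinv :: "'d \<Rightarrow> 'd"

locale dart_graph =
  fixes \<Gamma> :: "('v, 'd) dgraph"
  assumes verts_nonempty: "verts \<Gamma> \<noteq> {}"
    and beg_closed: "\<And>x. x \<in> darts \<Gamma> \<Longrightarrow> beg \<Gamma> x \<in> verts \<Gamma>"
    and dinv_closed: "\<And>x. x \<in> darts \<Gamma> \<Longrightarrow> dinv \<Gamma> x \<in> darts \<Gamma>"
    and dinv_dinv: "\<And>x. x \<in> darts \<Gamma> \<Longrightarrow> dinv \<Gamma> (dinv \<Gamma> x) = x"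

definition dend :: "('v, 'd) dgraph \<Rightarrow> 'd \<Rightarrow> 'v" where
  "dend \<Gamma> x = beg \<Gamma> (dinv \<Gamma> x)"

fun walk :: "('v, 'd) dgraph \<Rightarrow> 'v \<Rightarrow> 'd list \<Rightarrow> 'v \<Rightarrow> bool" where
  "walk \<Gamma> u [] v \<longleftrightarrow> u \<in> verts \<Gamma> \<and> u = v"
| "walk \<Gamma> u (x # xs) v \<longleftrightarrow> x \<in> darts \<Gamma> \<and> beg \<Gamma> x = u \<and> walk \<Gamma> (dend \<Gamma> x) xs v"

definition connected_graph :: "('v, 'd) dgraph \<Rightarrow> bool" where
  "connected_graph \<Gamma> \<longleftrightarrow> dart_graph \<Gamma> \<and>
     (\<forall>u \<in> verts \<Gamma>. \<forall>v \<in> verts \<Gamma>. \<exists>xs. walk \<Gamma> u xs v)"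

text \<open>A cycle is a non-empty closed walk that repeats no vertex and does not use both darts of
  an edge, i.e. does not go back along a dart just traversed. Length 1 covers loops and semi-edges
  (a semi-edge \<open>x = x\<inverse>\<close> is a cycle by itself), length 2 covers parallel edges; see the
  lemmas on trees below.\<close>

definition cycle :: "('v, 'd) dgraph \<Rightarrow> 'd list \<Rightarrow> bool" where
  "cycle \<Gamma> xs \<longleftrightarrow> xs \<noteq> [] \<and> (\<exists>u. walk \<Gamma> u xs u) \<and> distinct (map (beg \<Gamma>) xs) \<and>
     (\<forall>x \<in> set xs. dinv \<Gamma> x \<in> set xs \<longrightarrow> dinv \<Gamma> x = x)"

definition tree :: "('v, 'd) dgraph \<Rightarrow> bool" where
  "tree \<Gamma> \<longleftrightarrow> connected_graph \<Gamma> \<and> (\<nexists>xs. cycle \<Gamma> xs)"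

lemma tree_no_loops_or_semi_edges:
  assumes "tree \<Gamma>" and x: "x \<in> darts \<Gamma>"
  shows "dend \<Gamma> x \<noteq> beg \<Gamma> x" and "dinv \<Gamma> x \<noteq> x"
proof -
  interpret dart_graph \<Gamma> using assms by (simp add: tree_def connected_graph_def)
  show *: "dend \<Gamma> x \<noteq> beg \<Gamma> x"
  proof
    assume "dend \<Gamma> x = beg \<Gamma> x"
    then have "cycle \<Gamma> [x]" using x beg_closed by (auto simp: cycle_def)
    then show False using assms by (auto simp: tree_def)
  qed
  then show "dinv \<Gamma> x \<noteq> x" by (auto simp: dend_def)
qed

lemma tree_no_parallel_edges:
  assumes "tree \<Gamma>" and x: "x \<in> darts \<Gamma>" and y: "y \<in> darts \<Gamma>"
    and "beg \<Gamma> x = beg \<Gamma> y" and "dend \<Gamma> x = dend \<Gamma> y"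
  shows "x = y"
proof (rule ccontr)
  interpret dart_graph \<Gamma> using assms by (simp add: tree_def connected_graph_def)
  assume "x \<noteq> y"
  moreover from this have "dinv \<Gamma> x \<noteq> dinv \<Gamma> y" using x y dinv_dinv by metis
  moreover have "x \<noteq> dinv \<Gamma> y" "beg \<Gamma> y \<noteq> dend \<Gamma> y"
    using assms tree_no_loops_or_semi_edges(1)[OF assms(1) y] by (auto simp: dend_def)
  ultimately have "cycle \<Gamma> [x, dinv \<Gamma> y]"
    using assms beg_closed[OF y] dinv_closed[OF y] dinv_dinv
    by (auto simp: cycle_def dend_def)
  then show False using assms by (auto simp: tree_def)
qed

definition subgraph :: "('v, 'd) dgraph \<Rightarrow> ('v, 'd) dgraph \<Rightarrow> bool" where
  "subgraph T \<Gamma> \<longleftrightarrow> dart_graph T \<and> verts T \<subseteq> verts \<Gamma> \<and> darts T \<subseteq> darts \<Gamma> \<and>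
     (\<forall>x \<in> darts T. beg T x = beg \<Gamma> x \<and> dinv T x = dinv \<Gamma> x)"

definition spanning_tree :: "('v, 'd) dgraph \<Rightarrow> ('v, 'd) dgraph \<Rightarrow> bool" where
  "spanning_tree T \<Gamma> \<longleftrightarrow> subgraph T \<Gamma> \<and> verts T = verts \<Gamma> \<and> tree T"

definition graph_isomorphic :: "('v, 'd) dgraph \<Rightarrow> ('w, 'e) dgraph \<Rightarrow> bool" (infix "\<cong>\<^sub>g" 50) where
  "\<Gamma> \<cong>\<^sub>g \<Gamma>' \<longleftrightarrow> (\<exists>f h. bij_betw f (verts \<Gamma>) (verts \<Gamma>') \<and> bij_betw h (darts \<Gamma>) (darts \<Gamma>') \<and>
     (\<forall>x \<in> darts \<Gamma>. f (beg \<Gamma> x) = beg \<Gamma>' (h x) \<and> h (dinv \<Gamma> x) = dinv \<Gamma>' (h x)))"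

text \<open>The weight function is defined on the disjoint union of the vertices and the darts.
  The conjugate \<open>H\<^sup>h\<close> is \<open>h\<inverse>Hh\<close>.\<close>

locale gen_voltage_graph = group G for G (structure) +
  fixes \<Delta> :: "('v, 'd) dgraph"
    and \<omega> :: "'v + 'd \<Rightarrow> 'a set"
    and \<zeta> :: "'d \<Rightarrow> 'a"
  assumes base_connected: "connected_graph \<Delta>"
    and weight_vert: "\<And>v. v \<in> verts \<Delta> \<Longrightarrow> subgroup (\<omega> (Inl v)) G"
    and weight_dart: "\<And>x. x \<in> darts \<Delta> \<Longrightarrow> subgroup (\<omega> (Inr x)) G"
    and voltage_closed: "\<And>x. x \<in> darts \<Delta> \<Longrightarrow> \<zeta> x \<in> carrier G"
    and weight_beg: "\<And>x. x \<in> darts \<Delta> \<Longrightarrow> \<omega> (Inr x) \<subseteq> \<omega> (Inl (beg \<Delta> x))"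
    and weight_dinv:
      "\<And>x. x \<in> darts \<Delta> \<Longrightarrow> \<omega> (Inr x) = (inv (\<zeta> x) <# \<omega> (Inr (dinv \<Delta> x))) #> \<zeta> x"
    and voltage_dinv: "\<And>x. x \<in> darts \<Delta> \<Longrightarrow> \<zeta> (dinv \<Delta> x) \<otimes> \<zeta> x \<in> \<omega> (Inr x)"

text \<open>The incidence maps of the generalised cover are given on a coset through a chosen
  representative; the lemmas \<open>beg_gen_cov\<close> and \<open>dinv_gen_cov\<close> below show that the choice is
  irrelevant.\<close>

definition coset_rep :: "('a, 'b) monoid_scheme \<Rightarrow> 'a set \<Rightarrow> 'a set \<Rightarrow> 'a" where
  "coset_rep G H C = (SOME g. g \<in> carrier G \<and> C = H #>\<^bsub>G\<^esub> g)"

definition gen_cov ::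
  "('v, 'd) dgraph \<Rightarrow> ('a, 'b) monoid_scheme \<Rightarrow> ('v + 'd \<Rightarrow> 'a set) \<Rightarrow> ('d \<Rightarrow> 'a)
    \<Rightarrow> ('v \<times> 'a set, 'd \<times> 'a set) dgraph" where
  "gen_cov \<Delta> G \<omega> \<zeta> =
    \<lparr>verts = {(v, \<omega> (Inl v) #>\<^bsub>G\<^esub> g) | v g. v \<in> verts \<Delta> \<and> g \<in> carrier G},
     darts = {(x, \<omega> (Inr x) #>\<^bsub>G\<^esub> g) | x g. x \<in> darts \<Delta> \<and> g \<in> carrier G},
     beg = (\<lambda>(x, C). (beg \<Delta> x, \<omega> (Inl (beg \<Delta> x)) #>\<^bsub>G\<^esub> coset_rep G (\<omega> (Inr x)) C)),
     dinv = (\<lambda>(x, C). (dinv \<Delta> x,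
       \<omega> (Inr (dinv \<Delta> x)) #>\<^bsub>G\<^esub> (\<zeta> x \<otimes>\<^bsub>G\<^esub> coset_rep G (\<omega> (Inr x)) C)))\<rparr>"

context gen_voltage_graph
begin

lemma coset_repE:
  assumes "subgroup H G" "g \<in> carrier G"
  obtains h where "h \<in> H" "coset_rep G H (H #> g) = h \<otimes> g"
proof -
  let ?r = "coset_rep G H (H #> g)"
  have "?r \<in> carrier G \<and> H #> g = H #> ?r"
    unfolding coset_rep_def by (rule someI[of _ g]) (simp add: assms)
  then have "?r \<in> H #> g" using assms rcos_self by blast
  then show ?thesis using that by (auto simp: r_coset_def)
qed

lemma coset_absorb:
  assumes "subgroup H G" "h \<in> H" "g \<in> carrier G"
  shows "H #> (h \<otimes> g) = H #> g"
proof -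
  have h: "h \<in> carrier G" and "H \<subseteq> carrier G"
    using subgroup.mem_carrier[OF assms(1,2)] subgroup.subset[OF assms(1)] by simp_all
  then have "H #> (h \<otimes> g) = H #> h #> g" using assms(3) by (simp add: coset_mult_assoc)
  also have "H #> h = H" using coset_join2[OF h assms(1,2)] .
  finally show ?thesis .
qed

lemma beg_gen_cov:
  assumes "x \<in> darts \<Delta>" "g \<in> carrier G"
  shows "beg (gen_cov \<Delta> G \<omega> \<zeta>) (x, \<omega> (Inr x) #> g) = (beg \<Delta> x, \<omega> (Inl (beg \<Delta> x)) #> g)"
proof -
  interpret D: dart_graph \<Delta> using base_connected by (simp add: connected_graph_def)
  obtain h where "h \<in> \<omega> (Inr x)" "coset_rep G (\<omega> (Inr x)) (\<omega> (Inr x) #> g) = h \<otimes> g"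
    using coset_repE weight_dart assms by blast
  then show ?thesis
    using coset_absorb[OF weight_vert[OF D.beg_closed[OF assms(1)]], of h g]
      weight_beg[OF assms(1)] assms
    by (simp add: gen_cov_def subset_iff)
qed

lemma dinv_gen_cov:
  assumes x: "x \<in> darts \<Delta>" and g: "g \<in> carrier G"
  shows "dinv (gen_cov \<Delta> G \<omega> \<zeta>) (x, \<omega> (Inr x) #> g) =
    (dinv \<Delta> x, \<omega> (Inr (dinv \<Delta> x)) #> (\<zeta> x \<otimes> g))"
proof -
  interpret D: dart_graph \<Delta> using base_connected by (simp add: connected_graph_def)
  let ?K = "\<omega> (Inr (dinv \<Delta> x))"
  have K: "subgroup ?K G" using weight_dart D.dinv_closed x by blast
  obtain h where h: "h \<in> \<omega> (Inr x)"
    and r: "coset_rep G (\<omega> (Inr x)) (\<omega> (Inr x) #> g) = h \<otimes> g"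
    using coset_repE weight_dart x g by blast
  obtain k where k: "k \<in> ?K" "h = inv (\<zeta> x) \<otimes> k \<otimes> \<zeta> x"
    using h weight_dinv[OF x] by (auto simp: r_coset_def l_coset_def)
  have kc: "k \<in> carrier G" using subgroup.mem_carrier[OF K k(1)] .
  have z: "\<zeta> x \<in> carrier G" using voltage_closed x by blast
  have hc: "h \<in> carrier G" using subgroup.mem_carrier[OF weight_dart[OF x] h] .
  have "h = inv (\<zeta> x) \<otimes> (k \<otimes> \<zeta> x)"
    unfolding k(2) by (rule m_assoc[OF inv_closed[OF z] kc z])
  then have "k \<otimes> \<zeta> x = \<zeta> x \<otimes> h"
    using inv_solve_left[OF hc z m_closed[OF kc z]] by blast
  then have eq: "\<zeta> x \<otimes> (h \<otimes> g) = k \<otimes> (\<zeta> x \<otimes> g)"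
    using m_assoc[OF z hc g] m_assoc[OF kc z g] by metis
  have "dinv (gen_cov \<Delta> G \<omega> \<zeta>) (x, \<omega> (Inr x) #> g) = (dinv \<Delta> x, ?K #> (\<zeta> x \<otimes> (h \<otimes> g)))"
    by (simp add: gen_cov_def r)
  also have "\<dots> = (dinv \<Delta> x, ?K #> (\<zeta> x \<otimes> g))"
    unfolding eq coset_absorb[OF K k(1) m_closed[OF z g]] ..
  finally show ?thesis .
qed

lemma dart_graph_gen_cov: "dart_graph (gen_cov \<Delta> G \<omega> \<zeta>)"
proof -
  interpret D: dart_graph \<Delta> using base_connected by (simp add: connected_graph_def)
  let ?\<Gamma> = "gen_cov \<Delta> G \<omega> \<zeta>"
  have V: "(v, \<omega> (Inl v) #> g) \<in> verts ?\<Gamma>" if "v \<in> verts \<Delta>" "g \<in> carrier G" for v g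
    using that by (auto simp: gen_cov_def)
  have D: "(x, \<omega> (Inr x) #> g) \<in> darts ?\<Gamma>" if "x \<in> darts \<Delta>" "g \<in> carrier G" for x g
    using that by (auto simp: gen_cov_def)
  have DE: "\<exists>x g. p = (x, \<omega> (Inr x) #> g) \<and> x \<in> darts \<Delta> \<and> g \<in> carrier G"
    if "p \<in> darts ?\<Gamma>" for p
    using that by (auto simp: gen_cov_def)
  show ?thesis
  proof
    show "verts ?\<Gamma> \<noteq> {}" using D.verts_nonempty V by blast
  next
    fix p assume "p \<in> darts ?\<Gamma>"
    then obtain x g where p: "p = (x, \<omega> (Inr x) #> g)" and x: "x \<in> darts \<Delta>" and g: "g \<in> carrier G"
      using DE by blast
    note x' = D.dinv_closed[OF x]
    note z = voltage_closed[OF x] and z' = voltage_closed[OF x']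
    show "beg ?\<Gamma> p \<in> verts ?\<Gamma>" using p x g V D.beg_closed by (simp add: beg_gen_cov)
    show "dinv ?\<Gamma> p \<in> darts ?\<Gamma>" using p x x' z g D by (simp add: dinv_gen_cov)
    have "\<omega> (Inr x) #> (\<zeta> (dinv \<Delta> x) \<otimes> (\<zeta> x \<otimes> g)) = \<omega> (Inr x) #> g"
      using coset_absorb[OF weight_dart[OF x] voltage_dinv[OF x] g] z z' g by (simp add: m_assoc)
    then show "dinv ?\<Gamma> (dinv ?\<Gamma> p) = p"
      using p x x' z g by (simp add: dinv_gen_cov D.dinv_dinv)
  qed
qed

end

end

theory Submission
  imports Defs "HOL-Algebra.Group_Action"
begin

text \<open>Translating the fibre over each vertex \<open>v\<close> by a group element \<open>c v\<close>, and the fibre over each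
  dart \<open>x\<close> by \<open>c (beg x)\<close>, conjugates the weights and turns the voltage of \<open>x\<close> into
  \<open>c (end x) \<zeta>(x) (c (beg x))\<inverse>\<close>. On a tree, \<open>c\<close> can be chosen as the product of the voltages along
  the reduced walk to a root, so that every tree dart directed towards the root gets voltage \<open>1\<close>.
  The opposite dart \<open>x\<close> then has voltage in the weight of \<open>x\<inverse>\<close>, and multiplying a voltage from
  the left by elements of that weight does not change the cover.\<close>

section \<open>Reduced walks in trees\<close>

definition reduced :: "('v, 'd) dgraph \<Rightarrow> 'd list \<Rightarrow> bool" where
  "reduced \<Gamma> xs \<longleftrightarrow> successively (\<lambda>x y. y \<noteq> dinv \<Gamma> x) xs"

lemma walk_start: "walk \<Gamma> u (x # xs) v \<Longrightarrow> beg \<Gamma> x = u"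
  by simp

context dart_graph
begin

lemma dend_closed: "x \<in> darts \<Gamma> \<Longrightarrow> dend \<Gamma> x \<in> verts \<Gamma>"
  by (simp add: dend_def beg_closed dinv_closed)

lemma walk_append:
  "walk \<Gamma> u (xs @ ys) v \<longleftrightarrow> (\<exists>w. walk \<Gamma> u xs w \<and> walk \<Gamma> w ys v)"
proof (induction xs arbitrary: u)
  case Nil
  then show ?case by (cases ys) (auto simp: beg_closed)
qed auto

lemma walk_darts: "walk \<Gamma> u xs v \<Longrightarrow> set xs \<subseteq> darts \<Gamma>"
  by (induction xs arbitrary: u) auto

lemma walk_rev:
  assumes "walk \<Gamma> u xs v"
  shows "walk \<Gamma> v (rev (map (dinv \<Gamma>) xs)) u"
  using assms
proof (induction xs arbitrary: u)
  case (Cons x xs)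
  then show ?case
    by (auto simp: walk_append dinv_closed dinv_dinv dend_def beg_closed)
qed simp

lemma reduced_rev:
  assumes "reduced \<Gamma> xs" "set xs \<subseteq> darts \<Gamma>"
  shows "reduced \<Gamma> (rev (map (dinv \<Gamma>) xs))"
  using assms unfolding reduced_def successively_rev successively_map
  by (auto elim!: successively_mono simp: dinv_dinv)

text \<open>Suppose \<open>x\<close> and later \<open>dinv \<Gamma> x\<close> occur. The dart right
  after \<open>x\<close> starts at the end of \<open>x\<close>, as does
  \<open>dinv \<Gamma> x\<close>; distinct initial vertices make the two equal, so the walk
  backtracks. If \<open>dinv \<Gamma> x\<close> comes first, the two darts swap roles.\<close>

lemma cycle_if_distinct_reduced:
  assumes w: "walk \<Gamma> u xs u" and ne: "xs \<noteq> []" and red: "reduced \<Gamma> xs"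
    and dis: "distinct (map (beg \<Gamma>) xs)"
  shows "cycle \<Gamma> xs"
proof -
  have later: False if xs: "xs = as @ x # bs" and x': "dinv \<Gamma> x \<in> set bs" for as x bs
  proof -
    obtain b bs' where bs: "bs = b # bs'" using x' by (cases bs) auto
    have "beg \<Gamma> b = beg \<Gamma> (dinv \<Gamma> x)"
      using w unfolding xs bs walk_append by (auto simp: dend_def)
    then have "b = dinv \<Gamma> x"
      using dis x' unfolding xs bs distinct_map by (auto dest: inj_onD)
    then show False
      using red unfolding xs bs reduced_def successively_append_iff by simp
  qed
  have "dinv \<Gamma> x = x" if x: "x \<in> set xs" and x': "dinv \<Gamma> x \<in> set xs" for x
  proof (rule ccontr)
    assume "dinv \<Gamma> x \<noteq> x"
    obtain as bs where xs: "xs = as @ x # bs" using split_list[OF x] by blast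
    consider "dinv \<Gamma> x \<in> set as" | "dinv \<Gamma> x \<in> set bs"
      using x' \<open>dinv \<Gamma> x \<noteq> x\<close> unfolding xs by auto
    then show False
    proof cases
      case 1
      then obtain as1 as2 where "as = as1 @ dinv \<Gamma> x # as2" using split_list by fast
      moreover have "dinv \<Gamma> (dinv \<Gamma> x) = x" using x walk_darts[OF w] dinv_dinv by blast
      ultimately show False
        using later[of as1 "dinv \<Gamma> x" "as2 @ x # bs"] xs by simp
    next
      case 2
      then show False using later xs by blast
    qed
  qed
  then show ?thesis using w ne dis unfolding cycle_def by blast
qed

text \<open>If an initial vertex repeats, the segment between two of its visits is a shorter closed
  walk. It is again reduced, because \<open>reduced\<close> compares consecutive darts only and not
  the last dart with the first.\<close>

lemma reduced_closed_walk_imp_cycle: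
  assumes "walk \<Gamma> u xs u" "xs \<noteq> []" "reduced \<Gamma> xs"
  shows "\<exists>ys. cycle \<Gamma> ys"
  using assms
proof (induction xs arbitrary: u rule: length_induct)
  case (1 xs)
  show ?case
  proof (cases "distinct (map (beg \<Gamma>) xs)")
    case True
    then show ?thesis using cycle_if_distinct_reduced 1 by blast
  next
    case False
    then obtain as b bs cs where "map (beg \<Gamma>) xs = as @ [b] @ bs @ [b] @ cs"
      using not_distinct_decomp by blast
    then obtain as' x bs' y cs' where xs: "xs = as' @ (x # bs') @ y # cs'"
      and xy: "beg \<Gamma> x = b" "beg \<Gamma> y = b"
      by (auto simp: map_eq_append_conv append_eq_map_conv map_eq_Cons_conv Cons_eq_map_conv)
    have "walk \<Gamma> b (x # bs') b"
      using "1.prems"(1) xy unfolding xs walk_append by (auto dest: walk_start)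
    moreover have "reduced \<Gamma> (x # bs')"
      using "1.prems"(3) unfolding xs reduced_def successively_append_iff by simp
    moreover have "length (x # bs') < length xs" by (simp add: xs)
    ultimately show ?thesis using "1.IH" by blast
  qed
qed

lemma reduced_ConsD: "reduced \<Gamma> (x # xs) \<Longrightarrow> reduced \<Gamma> xs"
  by (cases xs) (auto simp: reduced_def)

text \<open>Reduction from the tail: a new first dart either extends the reduced walk or cancels
  against its head.\<close>

lemma reduced_walk_exists:
  assumes "walk \<Gamma> u xs v"
  shows "\<exists>ys. walk \<Gamma> u ys v \<and> reduced \<Gamma> ys"
  using assms
proof (induction xs arbitrary: u)
  case Nil
  then have "walk \<Gamma> u [] v" "reduced \<Gamma> []" by (auto simp: reduced_def)
  then show ?case by blast
next
  case (Cons x xs)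
  then obtain ys where ys: "walk \<Gamma> (dend \<Gamma> x) ys v" "reduced \<Gamma> ys" by auto
  have x: "x \<in> darts \<Gamma>" "beg \<Gamma> x = u" using Cons.prems by auto
  show ?case
  proof (cases "\<exists>zs. ys = dinv \<Gamma> x # zs")
    case True
    then show ?thesis using ys x by (auto simp: dend_def dinv_dinv dest: reduced_ConsD)
  next
    case False
    then have "reduced \<Gamma> (x # ys)" using ys(2) by (cases ys) (auto simp: reduced_def)
    moreover have "walk \<Gamma> u (x # ys) v" using ys(1) x by simp
    ultimately show ?thesis by blast
  qed
qed

text \<open>Common first darts are stripped by induction. Once the first darts differ, going back
  along one walk and out along the other gives a reduced closed walk, hence a cycle.\<close>

lemma reduced_walk_unique:
  assumes acyclic: "\<nexists>zs. cycle \<Gamma> zs"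
    and "walk \<Gamma> u xs v" "reduced \<Gamma> xs" "walk \<Gamma> u ys v" "reduced \<Gamma> ys"
  shows "xs = ys"
  using assms(2-)
proof (induction xs arbitrary: u ys)
  case Nil
  then show ?case using reduced_closed_walk_imp_cycle acyclic by auto
next
  case (Cons x xs)
  show ?case
  proof (cases "\<exists>zs. ys = x # zs")
    case True
    then obtain zs where zs: "ys = x # zs" by blast
    have "xs = zs"
      using Cons.IH[of "dend \<Gamma> x" zs] Cons.prems reduced_ConsD unfolding zs by auto
    then show ?thesis by (simp add: zs)
  next
    case False
    \<comment> \<open>The junction is the only place where a backtrack could arise: the reversed
      walk ends in \<open>dinv \<Gamma> x\<close>, so \<open>ys\<close> would have to begin with
      \<open>x\<close>, which is excluded here.\<close>
    let ?ws = "rev (map (dinv \<Gamma>) (x # xs)) @ ys"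
    have "walk \<Gamma> v ?ws v"
      using walk_rev[OF Cons.prems(1)] Cons.prems(3) walk_append by blast
    moreover have "reduced \<Gamma> ?ws"
      using reduced_rev[OF Cons.prems(2) walk_darts[OF Cons.prems(1)]] Cons.prems(1,4) False
      unfolding reduced_def successively_append_iff
      by (cases ys) (auto simp: dinv_dinv)
    ultimately show ?thesis using reduced_closed_walk_imp_cycle acyclic by fastforce
  qed
qed

end

text \<open>The potential of \<open>v\<close> is the product of the values along the reduced walk from \<open>v\<close> to a
  fixed root; for each dart, the reduced walk of one end extends that of the other.\<close>

lemma tree_potential:
  fixes s :: "'c \<Rightarrow> 'd \<Rightarrow> 'c"
  assumes T: "tree T" and a: "a \<in> A" and s: "\<And>x c. x \<in> darts T \<Longrightarrow> c \<in> A \<Longrightarrow> s c x \<in> A"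
  obtains p where "\<And>v. v \<in> verts T \<Longrightarrow> p v \<in> A"
    and "\<And>x. x \<in> darts T \<Longrightarrow>
      p (beg T x) = s (p (dend T x)) x \<or> p (dend T x) = s (p (beg T x)) (dinv T x)"
proof -
  interpret dart_graph T using T by (simp add: tree_def connected_graph_def)
  obtain r where r: "r \<in> verts T" using verts_nonempty by blast
  define w where "w v = (SOME xs. walk T v xs r \<and> reduced T xs)" for v
  have w: "walk T v (w v) r" "reduced T (w v)" if v: "v \<in> verts T" for v
  proof -
    obtain xs where "walk T v xs r"
      using v r T unfolding tree_def connected_graph_def by blast
    then have "walk T v (w v) r \<and> reduced T (w v)"
      unfolding w_def by (rule someI_ex[OF reduced_walk_exists])
    then show "walk T v (w v) r" "reduced T (w v)" by auto
  qed
  have eq: "w v = xs" if "walk T v xs r" "reduced T xs" "v \<in> verts T" for v xs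
    using reduced_walk_unique that w T unfolding tree_def by blast
  \<comment> \<open>\<open>foldr\<close> starts with \<open>a\<close> at the root end, so prefixing
    \<open>x\<close> to a walk applies the step for \<open>x\<close> last.\<close>
  define f where "f xs = foldr (\<lambda>x c. s c x) xs a" for xs
  have "f xs \<in> A" if "set xs \<subseteq> darts T" for xs
    using that by (induction xs) (auto simp: f_def a s)
  then have "f (w v) \<in> A" if "v \<in> verts T" for v using that w walk_darts by blast
  moreover have "f (w (beg T x)) = s (f (w (dend T x))) x \<or>
      f (w (dend T x)) = s (f (w (beg T x))) (dinv T x)" if x: "x \<in> darts T" for x
  \<comment> \<open>If the walk from the end of \<open>x\<close> first goes back along
    \<open>x\<close>, its tail is the walk from the beginning, giving the second alternative.
    Otherwise prefixing \<open>x\<close> keeps it reduced, giving the first.\<close>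
  proof (cases "\<exists>zs. w (dend T x) = dinv T x # zs")
    case True
    then obtain zs where zs: "w (dend T x) = dinv T x # zs" by blast
    then have "walk T (beg T x) zs r" "reduced T zs"
      using w[OF dend_closed[OF x]] x by (auto simp: dend_def dinv_dinv dest: reduced_ConsD)
    then have "w (beg T x) = zs" using eq x beg_closed by blast
    then show ?thesis using zs by (simp add: f_def)
  next
    case False
    then have "reduced T (x # w (dend T x))"
      using w(2)[OF dend_closed[OF x]] by (cases "w (dend T x)") (auto simp: reduced_def)
    then have "w (beg T x) = x # w (dend T x)"
      using eq w(1)[OF dend_closed[OF x]] x beg_closed by simp
    then show ?thesis by (simp add: f_def)
  qed
  ultimately show ?thesis using that[of "\<lambda>v. f (w v)"] by blast
qed

section \<open>Isomorphic generalised covers\<close>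

lemma graph_isomorphic_trans [trans]:
  assumes "\<Gamma>1 \<cong>\<^sub>g \<Gamma>2" "\<Gamma>2 \<cong>\<^sub>g \<Gamma>3"
  shows "\<Gamma>1 \<cong>\<^sub>g \<Gamma>3"
proof -
  obtain f h where 1: "bij_betw f (verts \<Gamma>1) (verts \<Gamma>2)" "bij_betw h (darts \<Gamma>1) (darts \<Gamma>2)"
    "\<And>x. x \<in> darts \<Gamma>1 \<Longrightarrow> f (beg \<Gamma>1 x) = beg \<Gamma>2 (h x) \<and> h (dinv \<Gamma>1 x) = dinv \<Gamma>2 (h x)"
    using assms(1) unfolding graph_isomorphic_def by blast
  obtain f' h' where 2: "bij_betw f' (verts \<Gamma>2) (verts \<Gamma>3)" "bij_betw h' (darts \<Gamma>2) (darts \<Gamma>3)"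
    "\<And>x. x \<in> darts \<Gamma>2 \<Longrightarrow> f' (beg \<Gamma>2 x) = beg \<Gamma>3 (h' x) \<and> h' (dinv \<Gamma>2 x) = dinv \<Gamma>3 (h' x)"
    using assms(2) unfolding graph_isomorphic_def by blast
  have "h x \<in> darts \<Gamma>2" if "x \<in> darts \<Gamma>1" for x using 1(2) that by (auto simp: bij_betw_def)
  then show ?thesis
    unfolding graph_isomorphic_def using 1 2 bij_betw_trans[OF 1(1) 2(1)] bij_betw_trans[OF 1(2) 2(2)]
    by (intro exI[of _ "f' \<circ> f"] exI[of _ "h' \<circ> h"]) auto
qed

section \<open>Left translation of right cosets\<close>

context group
begin

lemma cancel_inv:
  assumes "x \<in> carrier G" "y \<in> carrier G"
  shows "inv x \<otimes> (x \<otimes> y) = y" and "x \<otimes> (inv x \<otimes> y) = y"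
  using assms by (simp_all add: m_assoc[symmetric])

text \<open>Insert \<open>inv c \<otimes> c\<close> between \<open>H\<close> and \<open>g\<close>:
  left translation turns right cosets of \<open>H\<close> into right cosets of a conjugate.\<close>

lemma translate_coset:
  assumes "H \<subseteq> carrier G" "c \<in> carrier G" "g \<in> carrier G"
  shows "c <# (H #> g) = ((c <# H) #> inv c) #> (c \<otimes> g)"
  using assms l_coset_subset_G[OF assms(1,2)]
  by (simp add: coset_assoc coset_mult_assoc cancel_inv)

text \<open>Translation by \<open>inv (c i)\<close> is the inverse map. The index set stands for the
  vertices or for the darts, so both halves of the isomorphism come from here.\<close>

lemma bij_betw_translate_cosets:
  assumes H: "\<And>i. i \<in> I \<Longrightarrow> H i \<subseteq> carrier G" and c: "\<And>i. i \<in> I \<Longrightarrow> c i \<in> carrier G"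
  shows "bij_betw (\<lambda>(i, C). (i, c i <# C))
    {(i, H i #> g) | i g. i \<in> I \<and> g \<in> carrier G}
    {(i, ((c i <# H i) #> inv (c i)) #> g) | i g. i \<in> I \<and> g \<in> carrier G}"
    (is "bij_betw ?f ?A ?B")
proof (rule bij_betwI[where g = "\<lambda>(i, C). (i, inv (c i) <# C)"])
  have cancel: "inv (c i) <# (c i <# (H i #> g)) = H i #> g" if "i \<in> I" "g \<in> carrier G" for i g
    using that H c by (simp add: lcos_m_assoc lcos_mult_one r_coset_subset_G)
  have eq: "((c i <# H i) #> inv (c i)) #> g = c i <# (H i #> (inv (c i) \<otimes> g))"
    if "i \<in> I" "g \<in> carrier G" for i g
    using translate_coset[OF H c, of i i "inv (c i) \<otimes> g"] that c by (simp add: cancel_inv)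
  show "?f \<in> ?A \<rightarrow> ?B" using translate_coset[OF H c] c by fastforce
  show "(\<lambda>(i, C). (i, inv (c i) <# C)) \<in> ?B \<rightarrow> ?A"
    using cancel eq c by fastforce
  show "(case ?f p of (i, C) \<Rightarrow> (i, inv (c i) <# C)) = p" if "p \<in> ?A" for p
    using that cancel by auto
  show "?f (case p of (i, C) \<Rightarrow> (i, inv (c i) <# C)) = p" if "p \<in> ?B" for p
    using that cancel eq c by auto
qed

end

section \<open>Gauge transformations of weights and voltages\<close>

context gen_voltage_graph
begin

lemma dart_graph_base: "dart_graph \<Delta>"
  using base_connected by (simp add: connected_graph_def)

lemma weight_subset:
  "v \<in> verts \<Delta> \<Longrightarrow> \<omega> (Inl v) \<subseteq> carrier G"
  "x \<in> darts \<Delta> \<Longrightarrow> \<omega> (Inr x) \<subseteq> carrier G"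
  using weight_vert weight_dart subgroup.subset by blast+

definition gauge_weight :: "('v \<Rightarrow> 'a) \<Rightarrow> 'v + 'd \<Rightarrow> 'a set" where
  "gauge_weight c i =
    (let g = c (case i of Inl v \<Rightarrow> v | Inr x \<Rightarrow> beg \<Delta> x) in (g <# \<omega> i) #> inv g)"

text \<open>The form is dictated by \<open>dinv\<close>: it sends the fibre over \<open>x\<close>,
  translated by \<open>c (beg \<Delta> x)\<close>, to the fibre over \<open>dinv \<Delta> x\<close>,
  translated by \<open>c (dend \<Delta> x)\<close>.\<close>

definition gauge_voltage :: "('v \<Rightarrow> 'a) \<Rightarrow> 'd \<Rightarrow> 'a" where
  "gauge_voltage c x = c (dend \<Delta> x) \<otimes> \<zeta> x \<otimes> inv (c (beg \<Delta> x))"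

lemma gauge_weight_simps:
  "gauge_weight c (Inl v) = (c v <# \<omega> (Inl v)) #> inv (c v)"
  "gauge_weight c (Inr x) = (c (beg \<Delta> x) <# \<omega> (Inr x)) #> inv (c (beg \<Delta> x))"
  by (simp_all add: gauge_weight_def Let_def)

lemma translate_gauge_coset:
  assumes "g \<in> carrier G"
  shows "v \<in> verts \<Delta> \<Longrightarrow> c v \<in> carrier G \<Longrightarrow>
      c v <# (\<omega> (Inl v) #> g) = gauge_weight c (Inl v) #> (c v \<otimes> g)"
    and "x \<in> darts \<Delta> \<Longrightarrow> c (beg \<Delta> x) \<in> carrier G \<Longrightarrow>
      c (beg \<Delta> x) <# (\<omega> (Inr x) #> g) = gauge_weight c (Inr x) #> (c (beg \<Delta> x) \<otimes> g)"
  using assms by (simp_all add: gauge_weight_simps translate_coset weight_subset)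

lemma gen_voltage_graph_gauge:
  assumes c: "\<And>v. v \<in> verts \<Delta> \<Longrightarrow> c v \<in> carrier G"
  shows "gen_voltage_graph G \<Delta> (gauge_weight c) (gauge_voltage c)"
proof -
  interpret D: dart_graph \<Delta> by (rule dart_graph_base)
  note cb = c[OF D.beg_closed] and ce = c[OF D.dend_closed]
  show ?thesis
  proof (intro gen_voltage_graph.intro gen_voltage_graph_axioms.intro group_axioms)
    show "connected_graph \<Delta>" by (rule base_connected)
    show "subgroup (gauge_weight c (Inl v)) G" if "v \<in> verts \<Delta>" for v
      unfolding gauge_weight_simps using that by (intro subgroup_conjugation_is_surj2 c weight_vert)
    show "subgroup (gauge_weight c (Inr x)) G" if "x \<in> darts \<Delta>" for x
      unfolding gauge_weight_simps using that by (intro subgroup_conjugation_is_surj2 cb weight_dart)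
    show "gauge_voltage c x \<in> carrier G" if "x \<in> darts \<Delta>" for x
      using that cb ce voltage_closed by (simp add: gauge_voltage_def)
    show "gauge_weight c (Inr x) \<subseteq> gauge_weight c (Inl (beg \<Delta> x))" if "x \<in> darts \<Delta>" for x
      using weight_beg[OF that] unfolding gauge_weight_simps l_coset_def r_coset_def by blast
  next
    fix x assume x: "x \<in> darts \<Delta>"
    let ?b = "c (beg \<Delta> x)" and ?e = "c (dend \<Delta> x)" and ?K = "\<omega> (Inr (dinv \<Delta> x))"
    note z = voltage_closed[OF x] and z' = voltage_closed[OF D.dinv_closed[OF x]]
    note b = cb[OF x] and e = ce[OF x]
    have K: "?K \<subseteq> carrier G" using weight_subset x D.dinv_closed by blast
    \<comment> \<open>The weight of \<open>dinv \<Delta> x\<close> is conjugated by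
      \<open>?e\<close>, since that dart begins at the end of \<open>x\<close>. The factors
      \<open>?e\<close> cancel, leaving the old condition conjugated by \<open>?b\<close>.\<close>
    have "(inv (gauge_voltage c x) <# gauge_weight c (Inr (dinv \<Delta> x))) #> gauge_voltage c x
        = ((inv (gauge_voltage c x) \<otimes> ?e) <# ?K) #> (inv ?e \<otimes> gauge_voltage c x)"
      using K b e z unfolding gauge_weight_simps gauge_voltage_def dend_def[symmetric]
      by (simp add: coset_assoc lcos_m_assoc coset_mult_assoc l_coset_subset_G)
    also have "inv ?e \<otimes> gauge_voltage c x = \<zeta> x \<otimes> inv ?b"
      using b e z by (simp add: gauge_voltage_def m_assoc[symmetric])
    also have "inv (gauge_voltage c x) \<otimes> ?e = ?b \<otimes> inv (\<zeta> x)"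
      using b e z by (simp add: gauge_voltage_def m_assoc inv_mult_group)
    also have "((?b \<otimes> inv (\<zeta> x)) <# ?K) #> (\<zeta> x \<otimes> inv ?b)
        = (?b <# ((inv (\<zeta> x) <# ?K) #> \<zeta> x)) #> inv ?b"
      using K b z by (simp add: coset_assoc lcos_m_assoc coset_mult_assoc l_coset_subset_G)
    finally show "gauge_weight c (Inr x) =
        (inv (gauge_voltage c x) <# gauge_weight c (Inr (dinv \<Delta> x))) #> gauge_voltage c x"
      unfolding weight_dinv[OF x, symmetric] gauge_weight_simps by simp
    \<comment> \<open>The product telescopes at \<open>?e\<close>, so it is the old product
      conjugated by \<open>?b\<close>.\<close>
    have "gauge_voltage c (dinv \<Delta> x) \<otimes> gauge_voltage c x
        = ?b \<otimes> (\<zeta> (dinv \<Delta> x) \<otimes> \<zeta> x) \<otimes> inv ?b"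
      using b e z z' x by (simp add: gauge_voltage_def m_assoc cancel_inv dend_def D.dinv_dinv)
    then show "gauge_voltage c (dinv \<Delta> x) \<otimes> gauge_voltage c x \<in> gauge_weight c (Inr x)"
      using voltage_dinv[OF x] unfolding gauge_weight_simps l_coset_def r_coset_def by blast
  qed
qed

lemma gen_cov_gauge:
  assumes c: "\<And>v. v \<in> verts \<Delta> \<Longrightarrow> c v \<in> carrier G"
  shows "gen_cov \<Delta> G \<omega> \<zeta> \<cong>\<^sub>g gen_cov \<Delta> G (gauge_weight c) (gauge_voltage c)"
proof -
  interpret D: dart_graph \<Delta> by (rule dart_graph_base)
  interpret W: gen_voltage_graph G \<Delta> "gauge_weight c" "gauge_voltage c"
    by (rule gen_voltage_graph_gauge) (rule c)
  let ?\<Gamma> = "gen_cov \<Delta> G \<omega> \<zeta>" and ?\<Gamma>' = "gen_cov \<Delta> G (gauge_weight c) (gauge_voltage c)"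
  let ?f = "\<lambda>(v, C). (v, c v <# C)" and ?h = "\<lambda>(x, C). (x, c (beg \<Delta> x) <# C)"
  have "bij_betw ?f (verts ?\<Gamma>) (verts ?\<Gamma>')"
    using bij_betw_translate_cosets[of "verts \<Delta>" "\<lambda>v. \<omega> (Inl v)" c] weight_subset c
    by (simp add: gen_cov_def gauge_weight_simps)
  moreover have "bij_betw ?h (darts ?\<Gamma>) (darts ?\<Gamma>')"
    using bij_betw_translate_cosets[of "darts \<Delta>" "\<lambda>x. \<omega> (Inr x)" "\<lambda>x. c (beg \<Delta> x)"]
      weight_subset c D.beg_closed
    by (simp add: gen_cov_def gauge_weight_simps)
  moreover have "?f (beg ?\<Gamma> p) = beg ?\<Gamma>' (?h p) \<and> ?h (dinv ?\<Gamma> p) = dinv ?\<Gamma>' (?h p)"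
    if p': "p \<in> darts ?\<Gamma>" for p
  proof -
    obtain x g where p: "p = (x, \<omega> (Inr x) #> g)" and x: "x \<in> darts \<Delta>" and g: "g \<in> carrier G"
      using p' by (auto simp: gen_cov_def)
    let ?b = "c (beg \<Delta> x)" and ?e = "c (dend \<Delta> x)"
    note z = voltage_closed[OF x]
    have b: "?b \<in> carrier G" and e: "?e \<in> carrier G" using c D.beg_closed D.dend_closed x by auto
    have hp: "?h p = (x, gauge_weight c (Inr x) #> (?b \<otimes> g))"
      using x b g by (simp add: p translate_gauge_coset)
    have "?f (beg ?\<Gamma> p) = beg ?\<Gamma>' (?h p)"
      unfolding hp using x b g
      by (simp add: p beg_gen_cov W.beg_gen_cov translate_gauge_coset D.beg_closed)
    moreover have "?h (dinv ?\<Gamma> p) = dinv ?\<Gamma>' (?h p)"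
    proof -
      \<comment> \<open>Both ways round the square for \<open>dinv\<close> thus reach the same
        representative over \<open>dinv \<Delta> x\<close>, where the translation is by
        \<open>?e\<close>.\<close>
      have "gauge_voltage c x \<otimes> (?b \<otimes> g) = ?e \<otimes> (\<zeta> x \<otimes> g)"
        using b e g z by (simp add: gauge_voltage_def m_assoc cancel_inv)
      then show ?thesis
        unfolding hp using x b e g z translate_gauge_coset(2)[of "\<zeta> x \<otimes> g" "dinv \<Delta> x" c]
        by (simp add: p dinv_gen_cov W.dinv_gen_cov dend_def D.dinv_closed)
    qed
    ultimately show ?thesis by blast
  qed
  ultimately show ?thesis unfolding graph_isomorphic_def by blast
qed

section \<open>Changing voltages within a coset of the weight of the inverse dart\<close>

context
  fixes \<zeta>' :: "'d \<Rightarrow> 'a"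
  assumes coset: "\<And>x. x \<in> darts \<Delta> \<Longrightarrow> \<zeta>' x \<in> \<omega> (Inr (dinv \<Delta> x)) #> \<zeta> x"
begin

text \<open>The extra factor \<open>k\<close> lies in the weight of \<open>dinv \<Delta> x\<close>,
  which it normalises, so the conjugation condition is unaffected. The product of opposite voltages
  only gains factors from the weight of \<open>x\<close>.\<close>

lemma gen_voltage_graph_change_voltage: "gen_voltage_graph G \<Delta> \<omega> \<zeta>'"
proof -
  interpret D: dart_graph \<Delta> by (rule dart_graph_base)
  have obt: "\<exists>k \<in> \<omega> (Inr (dinv \<Delta> x)). \<zeta>' x = k \<otimes> \<zeta> x \<and> k \<in> carrier G" if "x \<in> darts \<Delta>" for x
    using coset[OF that] weight_subset(2)[OF D.dinv_closed[OF that]] by (auto simp: r_coset_def)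
  show ?thesis
  proof (intro gen_voltage_graph.intro gen_voltage_graph_axioms.intro group_axioms)
    show "\<zeta>' x \<in> carrier G" if "x \<in> darts \<Delta>" for x
      using obt[OF that] voltage_closed[OF that] by auto
  next
    fix x assume x: "x \<in> darts \<Delta>"
    let ?K = "\<omega> (Inr (dinv \<Delta> x))"
    note x' = D.dinv_closed[OF x]
    note z = voltage_closed[OF x] and z' = voltage_closed[OF x'] and H = weight_dart[OF x]
    have K: "subgroup ?K G" "?K \<subseteq> carrier G" using weight_dart weight_subset x' by auto
    obtain k where k: "k \<in> ?K" "\<zeta>' x = k \<otimes> \<zeta> x" "k \<in> carrier G" using obt[OF x] by blast
    obtain l where l: "l \<in> \<omega> (Inr x)" "\<zeta>' (dinv \<Delta> x) = l \<otimes> \<zeta> (dinv \<Delta> x)" "l \<in> carrier G"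
      using obt[OF x'] D.dinv_dinv[OF x] by auto
    have "(inv (\<zeta>' x) <# ?K) #> \<zeta>' x = (inv (\<zeta> x) <# (inv k <# ?K #> k)) #> \<zeta> x"
      unfolding k(2) using K k(3) z
      by (simp add: inv_mult_group coset_assoc lcos_m_assoc coset_mult_assoc l_coset_subset_G)
    also have "inv k <# ?K #> k = ?K"
      using coset_join3[OF _ K(1), of "inv k"] coset_join2[OF k(3) K(1) k(1)]
        subgroup.m_inv_closed[OF K(1) k(1)] k(3) by simp
    finally show "\<omega> (Inr x) = (inv (\<zeta>' x) <# ?K) #> \<zeta>' x" using weight_dinv[OF x] by simp
    \<comment> \<open>Moving \<open>k\<close> to the right past \<open>\<zeta> x\<close> turns it
      into \<open>?m\<close>, which \<open>weight_dinv\<close> places in the weight of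
      \<open>x\<close>.\<close>
    let ?m = "inv (\<zeta> x) \<otimes> k \<otimes> \<zeta> x"
    have m: "?m \<in> \<omega> (Inr x)"
      using k(1) unfolding weight_dinv[OF x] l_coset_def r_coset_def by blast
    have "\<zeta>' (dinv \<Delta> x) \<otimes> \<zeta>' x = l \<otimes> (\<zeta> (dinv \<Delta> x) \<otimes> \<zeta> x) \<otimes> ?m"
      unfolding k l using k(3) l(3) z z' by (simp add: m_assoc cancel_inv)
    then show "\<zeta>' (dinv \<Delta> x) \<otimes> \<zeta>' x \<in> \<omega> (Inr x)"
      using subgroup.m_closed[OF H subgroup.m_closed[OF H l(1) voltage_dinv[OF x]] m] by simp
  qed (use base_connected weight_vert weight_dart weight_beg in auto)
qed

text \<open>The coset on the left absorbs \<open>k\<close>, so both covers have the same incidence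
  maps on darts; the identity is an isomorphism.\<close>

lemma gen_cov_change_voltage: "gen_cov \<Delta> G \<omega> \<zeta> \<cong>\<^sub>g gen_cov \<Delta> G \<omega> \<zeta>'"
proof -
  interpret D: dart_graph \<Delta> by (rule dart_graph_base)
  interpret W: gen_voltage_graph G \<Delta> \<omega> \<zeta>' by (rule gen_voltage_graph_change_voltage)
  let ?\<Gamma> = "gen_cov \<Delta> G \<omega> \<zeta>" and ?\<Gamma>' = "gen_cov \<Delta> G \<omega> \<zeta>'"
  have "beg ?\<Gamma> p = beg ?\<Gamma>' p \<and> dinv ?\<Gamma> p = dinv ?\<Gamma>' p" if p': "p \<in> darts ?\<Gamma>" for p
  proof -
    obtain x g where p: "p = (x, \<omega> (Inr x) #> g)" and x: "x \<in> darts \<Delta>" and g: "g \<in> carrier G"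
      using p' by (auto simp: gen_cov_def)
    let ?K = "\<omega> (Inr (dinv \<Delta> x))"
    note K = weight_dart[OF D.dinv_closed[OF x]] and z = voltage_closed[OF x]
    obtain k where k: "k \<in> ?K" "\<zeta>' x = k \<otimes> \<zeta> x" using coset[OF x] by (auto simp: r_coset_def)
    then have "\<zeta>' x \<otimes> g = k \<otimes> (\<zeta> x \<otimes> g)"
      using subgroup.mem_carrier[OF K k(1)] z g by (simp add: m_assoc)
    then show ?thesis
      using coset_absorb[OF K k(1), of "\<zeta> x \<otimes> g"] x g z
      by (simp add: p beg_gen_cov W.beg_gen_cov dinv_gen_cov W.dinv_gen_cov)
  qed
  then show ?thesis unfolding graph_isomorphic_def
    by (intro exI[of _ id]) (simp add: gen_cov_def)
qed

end

end

section \<open>Normalising the voltages on the spanning tree\<close>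

theorem theorem26:
  fixes G :: "('a, 'b) monoid_scheme" (structure)
    and \<Delta> T :: "('v, 'd) dgraph"
    and \<omega> :: "'v + 'd \<Rightarrow> 'a set"
    and \<zeta> :: "'d \<Rightarrow> 'a"
  assumes "gen_voltage_graph G \<Delta> \<omega> \<zeta>"
    and "spanning_tree T \<Delta>"
  shows "\<exists>(\<zeta>' :: 'd \<Rightarrow> 'a) (\<omega>' :: 'v + 'd \<Rightarrow> 'a set).
    gen_voltage_graph G \<Delta> \<omega>' \<zeta>' \<and>
    (\<forall>x \<in> darts T. \<zeta>' x = \<one>) \<and>
    gen_cov \<Delta> G \<omega> \<zeta> \<cong>\<^sub>g gen_cov \<Delta> G \<omega>' \<zeta>'"
proof -
  interpret gen_voltage_graph G \<Delta> \<omega> \<zeta> by (rule assms(1))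
  interpret D: dart_graph \<Delta> by (rule dart_graph_base)
  have tree: "tree T" and verts: "verts T = verts \<Delta>" and darts: "darts T \<subseteq> darts \<Delta>"
    and sub: "\<And>x. x \<in> darts T \<Longrightarrow> beg T x = beg \<Delta> x \<and> dinv T x = dinv \<Delta> x"
    and T: "dart_graph T"
    using assms(2) by (auto simp: spanning_tree_def subgraph_def)
  have dend: "dend T x = dend \<Delta> x" if "x \<in> darts T" for x
    using sub[OF that] sub[OF dart_graph.dinv_closed[OF T that]] by (simp add: dend_def)
  \<comment> \<open>\<open>c\<close> is the tree potential with value \<open>\<one>\<close> at the
    root and right multiplication by the voltage as step.\<close>
  obtain c where c: "\<And>v. v \<in> verts \<Delta> \<Longrightarrow> c v \<in> carrier G"
    and step: "\<And>x. x \<in> darts T \<Longrightarrow> c (beg \<Delta> x) = c (dend \<Delta> x) \<otimes> \<zeta> x \<or>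
      c (dend \<Delta> x) = c (beg \<Delta> x) \<otimes> \<zeta> (dinv \<Delta> x)"
    using tree_potential[OF tree one_closed, of "\<lambda>c x. c \<otimes> \<zeta> x"] voltage_closed darts
    by (auto simp: verts sub dend subset_iff)
  interpret W: gen_voltage_graph G \<Delta> "gauge_weight c" "gauge_voltage c"
    by (rule gen_voltage_graph_gauge) (rule c)
  \<comment> \<open>Both darts of each tree edge are reset to \<open>\<one>\<close>;
    \<open>coset\<close> below shows that this stays within the permitted cosets.\<close>
  define \<zeta>' where "\<zeta>' x = (if x \<in> darts T then \<one> else gauge_voltage c x)" for x
  have trivial: "gauge_voltage c x = \<one>" if "x \<in> darts \<Delta>" "c (beg \<Delta> x) = c (dend \<Delta> x) \<otimes> \<zeta> x" for x
    using that c[OF D.dend_closed] c[OF D.beg_closed] voltage_closed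
    by (simp add: gauge_voltage_def)
  have coset: "\<zeta>' x \<in> gauge_weight c (Inr (dinv \<Delta> x)) #> gauge_voltage c x" if x: "x \<in> darts \<Delta>" for x
  proof -
    let ?K = "gauge_weight c (Inr (dinv \<Delta> x))"
    have K: "subgroup ?K G" using W.weight_dart D.dinv_closed x by blast
    note z = W.voltage_closed[OF x] and z' = W.voltage_closed[OF D.dinv_closed[OF x]]
    show ?thesis
    proof (cases "x \<in> darts T")
      case True
      \<comment> \<open>Away from the root the new voltage lies in \<open>?K\<close> but need not be trivial,
        as the voltages of \<open>x\<close> and \<open>dinv \<Delta> x\<close> need not be mutually inverse.\<close>
      have "gauge_voltage c x \<in> ?K"
        using step[OF True]
      proof
        assume "c (beg \<Delta> x) = c (dend \<Delta> x) \<otimes> \<zeta> x"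
        then show ?thesis using trivial x subgroup.one_closed[OF K] by simp
      next
        assume "c (dend \<Delta> x) = c (beg \<Delta> x) \<otimes> \<zeta> (dinv \<Delta> x)"
        then have "gauge_voltage c (dinv \<Delta> x) = \<one>"
          using trivial x D.dinv_closed by (simp add: dend_def D.dinv_dinv)
        \<comment> \<open>For \<open>dinv \<Delta> x\<close>, \<open>voltage_dinv\<close> puts the
          product of the voltage of \<open>x\<close> and that of \<open>dinv \<Delta> x\<close> into
          \<open>?K\<close>; the second factor is now \<open>\<one>\<close>.\<close>
        then show ?thesis
          using W.voltage_dinv[OF D.dinv_closed[OF x]] z by (simp add: D.dinv_dinv x)
      qed
      then have "?K #> gauge_voltage c x = ?K" using coset_join2[OF z K] by blast
      then show ?thesis using True subgroup.one_closed[OF K] by (simp add: \<zeta>'_def)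
    next
      case False
      then show ?thesis using rcos_self[OF z K] by (simp add: \<zeta>'_def)
    qed
  qed
  have "gen_voltage_graph G \<Delta> (gauge_weight c) \<zeta>'"
    by (rule W.gen_voltage_graph_change_voltage) (rule coset)
  moreover have "\<forall>x \<in> darts T. \<zeta>' x = \<one>" by (simp add: \<zeta>'_def)
  moreover have "gen_cov \<Delta> G \<omega> \<zeta> \<cong>\<^sub>g gen_cov \<Delta> G (gauge_weight c) \<zeta>'"
    using gen_cov_gauge[of c] W.gen_cov_change_voltage[of \<zeta>'] c coset graph_isomorphic_trans
    by blast
  ultimately show ?thesis by blast
qed

end
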